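(* Let $k, n \in \mathbb{N}$ and let $G$ be a $k$-regular graph on $n$ vertices with second eigenvalue $\lambda_2 = \lambda_2(G)$ and last eigenvalue $\lambda_n = \lambda_n(G)$. If the spectral gap satisfies $k - \lambda_2 < n/2$, then \[ 2\left( k - \frac{(k-\lambda_2)^2}{n} \right) \leq \frac{ \lambda_2 (\lambda_2 + 1) (2 \lambda_2 + 1)}{1 - \frac{2(k-\lambda_2)}{n}} - \lambda_2(3\lambda_2 + 1) \] and \[ -\lambda_n \leq \frac{ \lambda_2(\lambda_2 + 1) }{1 - \frac{2(k-\lambda_2)}{n} } - \lambda_2, \] with equality in both whenever $n = \binom{n - \mathrm{m}_G(\lambda_2) + 1}{2} - 1$.
   Context: $\mathbb{N}$ is the set of positive integers. Graphs are finite and simple. $\lambda_1(G) \geq \dots \geq \lambda_n(G)$ are the eigenvalues (with multiplicity) of the adjacency matrix of $G$, and $\mathrm{m}_G(\lambda)$ is the multiplicity of $\lambda$ as an eigenvalue of the adjacency matrix. Terminology: the paper describes the equality condition $n = \binom{n - \mathrm{m}_G(\lambda_2)+1}{2}-1$ as "$G$ is a strongly regular graph corresponding to a family of $\binom{r+1}{2}$ equiangular lines in $\mathbb{R}^r$ for $r = n - \mathrm{m}_G(\lambda_2)$". *)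

theory Defs
  imports "HOL-Analysis.Analysis"
begin

text \<open>
  A finite simple graph is a symmetric irreflexive adjacency relation \<open>E\<close> on a finite vertex type
  \<open>'v\<close>; the vertex set is the whole type, so the number of vertices is \<open>CARD('v)\<close>.
\<close>

definition simple_graph :: "('v::finite \<Rightarrow> 'v \<Rightarrow> bool) \<Rightarrow> bool" where
  "simple_graph E \<longleftrightarrow> symp E \<and> irreflp E"

definition regular_graph :: "nat \<Rightarrow> ('v::finite \<Rightarrow> 'v \<Rightarrow> bool) \<Rightarrow> bool" where
  "regular_graph k E \<longleftrightarrow> simple_graph E \<and> (\<forall>v. card {w. E v w} = k)"

definition adjacency_matrix :: "('v::finite \<Rightarrow> 'v \<Rightarrow> bool) \<Rightarrow> real ^ 'v ^ 'v" where
  "adjacency_matrix E = (\<chi> u v. if E u v then 1 else 0)"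

definition is_eigenvalue :: "real ^ 'n ^ 'n \<Rightarrow> real \<Rightarrow> bool" where
  "is_eigenvalue A \<mu> \<longleftrightarrow> (\<exists>x. x \<noteq> 0 \<and> A *v x = \<mu> *\<^sub>R x)"

text \<open>
  Multiplicity is the dimension of the eigenspace. It is used below only for adjacency matrices of
  simple graphs; these are real symmetric, so it agrees with the multiplicity as a root of the
  characteristic polynomial, and the multiplicities add up to the size of the matrix.
\<close>

definition eigenvalue_multiplicity :: "real ^ 'n ^ 'n \<Rightarrow> real \<Rightarrow> nat" where
  "eigenvalue_multiplicity A \<mu> = dim {x. A *v x = \<mu> *\<^sub>R x}"

definition eigenvalues_mset :: "real ^ 'n ^ 'n \<Rightarrow> real multiset" where
  "eigenvalues_mset A =
     (\<Sum>\<mu> \<in> {\<mu>. is_eigenvalue A \<mu>}. replicate_mset (eigenvalue_multiplicity A \<mu>) \<mu>)"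

text \<open>
  \<open>graph_eigenvalue E i\<close> is the \<open>i\<close>-th largest eigenvalue, counted with multiplicity, where \<open>i\<close>
  ranges over \<open>1, \<dots>, CARD('v)\<close>. List positions start at \<open>0\<close>, whence the shift.
\<close>

definition graph_eigenvalue :: "('v::finite \<Rightarrow> 'v \<Rightarrow> bool) \<Rightarrow> nat \<Rightarrow> real" where
  "graph_eigenvalue E i =
     rev (sorted_list_of_multiset (eigenvalues_mset (adjacency_matrix E))) ! (i - 1)"

definition graph_multiplicity :: "('v::finite \<Rightarrow> 'v \<Rightarrow> bool) \<Rightarrow> real \<Rightarrow> nat" where
  "graph_multiplicity E \<mu> = eigenvalue_multiplicity (adjacency_matrix E) \<mu>"

end

theory Submission
  imports Defs
begin

text \<open>
  Put \<open>l = \<lambda>\<^sub>2\<close>. Since \<open>k - l < n / 2\<close>, the matrix \<open>l I - A + J / 2\<close> is positive semidefinite, so it is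
  the Gram matrix of vectors \<open>v\<^sub>1, \<dots>, v\<^sub>n\<close> with equal norms and all inner products \<open>\<plusminus>1/2\<close>, that is, of
  equiangular lines. Their sum \<open>w\<close> has the same inner product \<open>s\<close> with each of them. For \<open>u\<close>
  orthogonal to \<open>w\<close>, projecting the symmetric matrix \<open>u w\<^sup>T + w u\<^sup>T\<close> onto the span of the
  \<open>v\<^sub>i v\<^sub>i\<^sup>T\<close> gives \<open>2 s \<Sum>\<^sub>i (u \<bullet> v\<^sub>i)\<^sup>2 \<le> l (l + 1) n (u \<bullet> u)\<close>. Taking for \<open>u\<close> the vector of an
  eigenvector of \<open>\<lambda>\<^sub>n\<close> yields the second bound, and \<open>u = v\<^sub>i - w / n\<close> the first. The matrix
  \<open>w w\<^sup>T / s\<^sup>2 - I / (l + 1 / 2)\<close> is orthogonal to all \<open>v\<^sub>i v\<^sub>i\<^sup>T\<close> and to \<open>u w\<^sup>T + w u\<^sup>T\<close>; if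
  \<open>n\<close> is one less than the dimension of the space of symmetric matrices, the projection is therefore
  exact and equality holds.
\<close>

subsection \<open>Orthonormal eigenbases of symmetric matrices\<close>

text \<open>The Rayleigh quotient attains its maximum \<open>\<mu>\<close> on the compact unit
  sphere of \<open>S\<close>. Then \<open>g\<close> is positive semidefinite on \<open>S\<close> and
  its form vanishes at the maximiser \<open>x\<close>, which forces \<open>g x = 0\<close>.\<close>

lemma selfadjoint_eigenvector_exists:
  fixes f :: "'a::euclidean_space \<Rightarrow> 'a"
  assumes lin: "linear f" and adj: "\<And>x y. f x \<bullet> y = x \<bullet> f y"
    and S: "subspace S" "f ` S \<subseteq> S" "S \<noteq> {0}"
  obtains x \<mu> where "x \<in> S" "norm x = 1" "f x = \<mu> *\<^sub>R x"
proof -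
  let ?K = "S \<inter> sphere 0 1"
  obtain z where z: "z \<in> S" "z \<noteq> 0"
    using S(1,3) subspace_0 by blast
  then have "z /\<^sub>R norm z \<in> ?K"
    using S(1) by (simp add: subspace_scale)
  then have "?K \<noteq> {}" by blast
  moreover have "compact ?K"
    using closed_subspace[OF S(1)] by (simp add: closed_Int_compact)
  moreover have "continuous_on ?K (\<lambda>x. x \<bullet> f x)"
    using linear_continuous_on[OF linear_conv_bounded_linear[THEN iffD1, OF lin]]
    by (intro continuous_intros)
  ultimately obtain x where x: "x \<in> ?K" and max: "\<And>y. y \<in> ?K \<Longrightarrow> y \<bullet> f y \<le> x \<bullet> f x"
    using continuous_attains_sup by metis
  define \<mu> where "\<mu> = x \<bullet> f x"
  define g where "g y = \<mu> *\<^sub>R y - f y" for y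
  have ling: "linear g"
    unfolding g_def using lin by (intro linear_compose_sub linear_scale_self) auto
  have adjg: "g y \<bullet> z = y \<bullet> g z" for y z
    by (simp add: g_def inner_diff_left inner_diff_right adj)
  have g_nonneg: "0 \<le> y \<bullet> g y" if "y \<in> S" for y
  proof (cases "y = 0")
    case False
    then have "(y /\<^sub>R norm y) \<bullet> f (y /\<^sub>R norm y) \<le> \<mu>"
      unfolding \<mu>_def using that S(1) by (intro max) (simp add: subspace_scale)
    then have "(y \<bullet> f y) / (norm y)\<^sup>2 \<le> \<mu>"
      by (simp add: linear_scale[OF lin] power2_eq_square divide_inverse mult_ac)
    then have "y \<bullet> f y \<le> \<mu> * (norm y)\<^sup>2"
      using False by (simp add: divide_le_eq)
    then show ?thesis
      by (simp add: g_def inner_diff_right power2_norm_eq_inner)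
  qed simp
  have "x \<bullet> x = 1"
    using x by (simp add: dot_square_norm)
  then have gx: "x \<bullet> g x = 0"
    by (simp add: g_def inner_diff_right \<mu>_def)
  have gxS: "g x \<in> S"
    using x S(1,2) by (auto simp: g_def intro!: subspace_diff subspace_scale)
  define h q where "h = g x \<bullet> g x" and "q = g x \<bullet> g (g x)"
  have "0 \<le> q" unfolding q_def using g_nonneg[OF gxS] .
  \<comment> \<open>Moving from \<open>x\<close> by \<open>t\<close> along \<open>g x\<close>
    changes the form by \<open>2 * t * h + t\<^sup>2 * q\<close>. This \<open>t\<close> makes the
    change negative unless \<open>h = 0\<close>; the denominator \<open>q + 1\<close> also covers
    \<open>q = 0\<close>.\<close>
  define t where "t = - h / (q + 1)"
  have "x + t *\<^sub>R g x \<in> S"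
    using x gxS S(1) by (auto intro!: subspace_add subspace_scale)
  then have "0 \<le> (x + t *\<^sub>R g x) \<bullet> g (x + t *\<^sub>R g x)"
    by (rule g_nonneg)
  moreover have "x \<bullet> g (g x) = h"
    unfolding h_def by (rule adjg[symmetric])
  ultimately have "0 \<le> 2 * t * h + t\<^sup>2 * q"
    using gx by (simp add: linear_add[OF ling] linear_scale[OF ling] inner_add_left inner_add_right
        h_def q_def power2_eq_square algebra_simps)
  also have "2 * t * h + t\<^sup>2 * q = - (h\<^sup>2 * (q + 2)) / (q + 1)\<^sup>2"
    using \<open>0 \<le> q\<close> by (simp add: t_def divide_simps) (simp add: power2_eq_square algebra_simps)
  finally have "h\<^sup>2 * (q + 2) \<le> 0"
    using \<open>0 \<le> q\<close> by (simp add: divide_le_0_iff)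
  then have "h = 0"
    using \<open>0 \<le> q\<close> by (simp add: mult_le_0_iff)
  then have "f x = \<mu> *\<^sub>R x"
    by (simp add: h_def g_def)
  with x show thesis by (intro that) auto
qed

text \<open>Induction on the dimension: split off a unit eigenvector; by self-adjointness its
  orthogonal complement in \<open>S\<close> is again invariant.\<close>

lemma selfadjoint_orthonormal_eigenbasis:
  fixes f :: "'a::euclidean_space \<Rightarrow> 'a"
  assumes lin: "linear f" and adj: "\<And>x y. f x \<bullet> y = x \<bullet> f y"
    and "subspace S" "f ` S \<subseteq> S"
  shows "\<exists>B. pairwise orthogonal B \<and> (\<forall>x\<in>B. norm x = 1 \<and> (\<exists>\<mu>. f x = \<mu> *\<^sub>R x)) \<and> span B = S"
  using assms(3,4)
proof (induction "dim S" arbitrary: S rule: less_induct)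
  case less
  show ?case
  proof (cases "S = {0}")
    case True
    then show ?thesis by (intro exI[of _ "{}"]) auto
  next
    case False
    then obtain x \<mu> where x: "x \<in> S" "norm x = 1" "f x = \<mu> *\<^sub>R x"
      using selfadjoint_eigenvector_exists[OF lin adj less.prems] by blast
    let ?T = "{y \<in> S. orthogonal x y}"
    have "subspace ?T"
      using less.prems(1) by (auto simp: subspace_def orthogonal_clauses)
    moreover have "f ` ?T \<subseteq> ?T"
    proof (rule image_subsetI)
      fix y assume "y \<in> ?T"
      then show "f y \<in> ?T"
        using less.prems(2) adj[of x y] x(3) by (auto simp: orthogonal_def)
    qed
    moreover have "dim ?T < dim S"
    proof -
      have "x \<notin> span ?T"
        using x(2) \<open>subspace ?T\<close> by (auto simp: span_eq_iff[THEN iffD2] orthogonal_def)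
      then have "span ?T \<subset> span S"
        using x(1) by (metis (no_types, lifting) mem_Collect_eq psubsetI span_base span_mono subsetI)
      then show ?thesis by (rule dim_psubset)
    qed
    ultimately obtain B where B: "pairwise orthogonal B"
      "\<forall>x\<in>B. norm x = 1 \<and> (\<exists>\<mu>. f x = \<mu> *\<^sub>R x)" "span B = ?T"
      using less.hyps by blast
    have "B \<subseteq> ?T" using B(3) span_superset by blast
    have "span (insert x B) = S"
    proof
      show "span (insert x B) \<subseteq> S"
        using \<open>B \<subseteq> ?T\<close> x(1) less.prems(1) by (intro span_minimal) auto
      show "S \<subseteq> span (insert x B)"
      proof
        fix y assume "y \<in> S"
        then have "y - (x \<bullet> y) *\<^sub>R x \<in> ?T"
          using x less.prems(1)
          by (auto simp: orthogonal_def inner_diff_right dot_square_norm intro!: subspace_diff subspace_scale)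
        then show "y \<in> span (insert x B)"
          using B(3) span_breakdown_eq by blast
      qed
    qed
    moreover have "pairwise orthogonal (insert x B)"
      using B(1) \<open>B \<subseteq> ?T\<close> by (auto simp: pairwise_insert orthogonal_commute)
    ultimately show ?thesis
      using B(2) x(2,3) by (intro exI[of _ "insert x B"]) auto
  qed
qed

text \<open>One eigenvector \<open>e\<close> is prescribed so that the all-ones direction can later
  belong to the basis. Indexing by \<open>'n\<close> lets basis vectors and coordinates share one
  type.\<close>

lemma orthonormal_eigenbasis_exists:
  fixes A :: "real ^ 'n ^ 'n"
  assumes sym: "transpose A = A" and e: "norm e = 1" "A *v e = \<kappa> *\<^sub>R e"
  obtains b :: "'n \<Rightarrow> real ^ 'n" and \<theta> :: "'n \<Rightarrow> real" and z
  where "\<And>p q. b p \<bullet> b q = (if p = q then 1 else 0)" "\<And>p. A *v b p = \<theta> p *\<^sub>R b p"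
    "b z = e" "\<theta> z = \<kappa>"
proof -
  have lin: "linear ((*v) A)" by (rule matrix_vector_mul_linear)
  have adj: "(A *v x) \<bullet> y = x \<bullet> (A *v y)" for x y
    using dot_lmul_matrix[of x A y] sym by (metis transpose_matrix_vector)
  let ?S = "{y. orthogonal e y}"
  have "(*v) A ` ?S \<subseteq> ?S"
    by (auto simp: orthogonal_def adj[symmetric] e(2))
  then obtain B where B: "pairwise orthogonal B"
      "\<forall>x\<in>B. norm x = 1 \<and> (\<exists>\<mu>. A *v x = \<mu> *\<^sub>R x)" "span B = ?S"
    using selfadjoint_orthonormal_eigenbasis[OF lin adj subspace_orthogonal_to_vector] by blast
  have "B \<subseteq> ?S" using B(3) span_superset by blast
  define C where "C = insert e B"
  have C: "pairwise orthogonal C" "\<And>x. x \<in> C \<Longrightarrow> norm x = 1" "\<And>x. x \<in> C \<Longrightarrow> \<exists>\<mu>. A *v x = \<mu> *\<^sub>R x"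
    using B(1,2) \<open>B \<subseteq> ?S\<close> e by (auto simp: C_def pairwise_insert orthogonal_commute)
  have "independent C"
    using pairwise_orthogonal_independent[OF C(1)] C(2) by fastforce
  have "y \<in> span C" for y
  proof -
    have "y - (e \<bullet> y) *\<^sub>R e \<in> span B"
      using e(1) by (simp add: B(3) orthogonal_def inner_diff_right dot_square_norm)
    then show ?thesis unfolding C_def span_breakdown_eq by blast
  qed
  then have "span C = UNIV" by auto
  then have "card C = CARD('n)"
    using dim_span_eq_card_independent[OF \<open>independent C\<close>] by (simp del: dim_span)
  then obtain b where b: "bij_betw b (UNIV :: 'n set) C"
    using finite_same_card_bij[of "UNIV :: 'n set" C] \<open>independent C\<close> independent_imp_finite by auto
  then have bC: "b p \<in> C" for p by (auto simp: bij_betw_def)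
  have "e \<in> range b" using b by (simp add: bij_betw_def C_def)
  then obtain z where "b z = e" by auto
  obtain \<theta> where \<theta>: "\<And>p. A *v b p = \<theta> p *\<^sub>R b p" using C(3)[OF bC] by metis
  have "\<theta> z = \<kappa>"
    using \<theta>[of z] e by (auto simp: \<open>b z = e\<close>)
  moreover have "b p \<bullet> b q = (if p = q then 1 else 0)" for p q
    using C(1) C(2)[OF bC[of p]] bC[of p] bC[of q] b
    by (auto simp: pairwise_def orthogonal_def dot_square_norm bij_betw_def inj_eq)
  ultimately show thesis using \<theta> \<open>b z = e\<close> that by blast
qed

section \<open>Spectral calculus in an orthonormal eigenbasis\<close>

locale orthonormal_eigenbasis =
  fixes A :: "real ^ 'n ^ 'n" and b :: "'n \<Rightarrow> real ^ 'n" and \<theta> :: "'n \<Rightarrow> real"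
  assumes orthonormal: "b p \<bullet> b q = (if p = q then 1 else 0)"
    and eigen: "A *v b p = \<theta> p *\<^sub>R b p"
begin

lemma inj_basis: "inj b"
  by (rule injI) (metis orthonormal zero_neq_one)

lemma pairwise_orthogonal_basis: "pairwise orthogonal (b ` I)"
  by (auto simp: pairwise_def orthogonal_def orthonormal)

lemma norm_basis: "norm (b p) = 1"
  by (simp add: norm_eq_1 orthonormal)

lemma independent_basis: "independent (b ` I)"
  using norm_basis by (intro pairwise_orthogonal_independent pairwise_orthogonal_basis)
    (metis imageE norm_zero zero_neq_one)

lemma span_basis: "span (range b) = UNIV"
proof -
  have "card (range b) = DIM(real ^ 'n)" by (simp add: card_image inj_basis)
  then show ?thesis
    using independent_basis[of UNIV] by (metis UNIV_I card_ge_dim_independent dim_UNIV order_refl subset_UNIV subset_antisym)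
qed

lemma expansion: "(\<Sum>p\<in>UNIV. (x \<bullet> b p) *\<^sub>R b p) = x"
proof -
  have "(\<Sum>y\<in>range b. (x \<bullet> y) *\<^sub>R y) = x"
    by (rule orthonormal_basis_expand[OF pairwise_orthogonal_basis]) (auto simp: norm_basis span_basis)
  then show ?thesis by (simp add: sum.reindex[OF inj_basis])
qed

lemma parseval: "x \<bullet> y = (\<Sum>p\<in>UNIV. (x \<bullet> b p) * (y \<bullet> b p))"
  by (subst expansion[of x, symmetric]) (simp add: inner_sum_left inner_commute[of "b _" y])

lemma mult_vec_expansion: "A *v x = (\<Sum>p\<in>UNIV. (\<theta> p * (x \<bullet> b p)) *\<^sub>R b p)"
proof -
  have "A *v (\<Sum>p\<in>UNIV. (x \<bullet> b p) *\<^sub>R b p) = (\<Sum>p\<in>UNIV. (\<theta> p * (x \<bullet> b p)) *\<^sub>R b p)"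
    by (simp add: linear_sum[OF matrix_vector_mul_linear] matrix_vector_mult_scaleR eigen mult.commute)
  then show ?thesis by (simp add: expansion)
qed

lemma mult_vec_inner_basis: "(A *v x) \<bullet> b p = \<theta> p * (x \<bullet> b p)"
  by (simp add: mult_vec_expansion inner_sum_left orthonormal if_distrib cong: if_cong)

lemma quadratic_form: "x \<bullet> (A *v x) = (\<Sum>p\<in>UNIV. \<theta> p * (x \<bullet> b p)\<^sup>2)"
  by (subst parseval) (simp add: mult_vec_inner_basis power2_eq_square mult_ac)

lemma sum_component_sq: "(\<Sum>i\<in>UNIV. (b p $ i)\<^sup>2) = 1"
  using orthonormal[of p p] by (simp add: inner_vec_def power2_eq_square)

text \<open>A diagonal entry is the quadratic form at a coordinate vector; expand it in the basis
  and swap the sums.\<close>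

lemma trace_eq: "(\<Sum>i\<in>UNIV. A $ i $ i) = (\<Sum>p\<in>UNIV. \<theta> p)"
proof -
  have "A $ i $ i = (\<Sum>p\<in>UNIV. \<theta> p * (b p $ i)\<^sup>2)" for i
    using quadratic_form[of "axis i 1"]
    by (simp add: inner_axis inner_axis' matrix_vector_mul_component)
  then have "(\<Sum>i\<in>UNIV. A $ i $ i) = (\<Sum>p\<in>UNIV. \<Sum>i\<in>UNIV. \<theta> p * (b p $ i)\<^sup>2)"
    by (simp only:) (rule sum.swap)
  then show ?thesis by (simp add: sum_distrib_left[symmetric] sum_component_sq)
qed

lemma frobenius_eq: "(\<Sum>i\<in>UNIV. (A *v axis i 1) \<bullet> (A *v axis i 1)) = (\<Sum>p\<in>UNIV. (\<theta> p)\<^sup>2)"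
proof -
  have "(A *v axis i 1) \<bullet> (A *v axis i 1) = (\<Sum>p\<in>UNIV. (\<theta> p)\<^sup>2 * (b p $ i)\<^sup>2)" for i
    by (subst parseval) (simp add: mult_vec_inner_basis inner_axis' power2_eq_square mult_ac)
  then have "(\<Sum>i\<in>UNIV. (A *v axis i 1) \<bullet> (A *v axis i 1)) = (\<Sum>p\<in>UNIV. \<Sum>i\<in>UNIV. (\<theta> p)\<^sup>2 * (b p $ i)\<^sup>2)"
    by (simp only:) (rule sum.swap)
  then show ?thesis by (simp add: sum_distrib_left[symmetric] sum_component_sq)
qed

text \<open>Pairing the eigenvector equation with \<open>b p\<close> kills the components of
  \<open>x\<close> that belong to other eigenvalues.\<close>

lemma eigenspace_eq_span: "{x. A *v x = \<mu> *\<^sub>R x} = span (b ` {p. \<theta> p = \<mu>})"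
proof
  show "{x. A *v x = \<mu> *\<^sub>R x} \<subseteq> span (b ` {p. \<theta> p = \<mu>})"
  proof clarify
    fix x assume x: "A *v x = \<mu> *\<^sub>R x"
    have "(x \<bullet> b p) *\<^sub>R b p \<in> span (b ` {p. \<theta> p = \<mu>})" for p
    proof (cases "\<theta> p = \<mu>")
      case True then show ?thesis by (intro span_scale span_base) auto
    next
      case False
      then have "x \<bullet> b p = 0" using mult_vec_inner_basis[of x p] by (simp add: x)
      then show ?thesis by (simp add: span_zero)
    qed
    then have "(\<Sum>p\<in>UNIV. (x \<bullet> b p) *\<^sub>R b p) \<in> span (b ` {p. \<theta> p = \<mu>})"
      by (intro span_sum)
    then show "x \<in> span (b ` {p. \<theta> p = \<mu>})" by (simp add: expansion)
  qed
  have "subspace {x. A *v x = \<mu> *\<^sub>R x}"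
    by (auto simp: subspace_def matrix_vector_right_distrib scaleR_add_right matrix_vector_mult_scaleR)
  then show "span (b ` {p. \<theta> p = \<mu>}) \<subseteq> {x. A *v x = \<mu> *\<^sub>R x}"
    by (intro span_minimal) (auto simp: eigen)
qed

lemma multiplicity_eq: "eigenvalue_multiplicity A \<mu> = card {p. \<theta> p = \<mu>}"
  unfolding eigenvalue_multiplicity_def eigenspace_eq_span
  by (simp add: dim_eq_card_independent independent_basis card_image inj_on_subset[OF inj_basis])

lemma is_eigenvalue_iff: "is_eigenvalue A \<mu> \<longleftrightarrow> \<mu> \<in> range \<theta>"
proof
  assume "is_eigenvalue A \<mu>"
  then obtain x where "x \<noteq> 0" "x \<in> span (b ` {p. \<theta> p = \<mu>})"
    unfolding is_eigenvalue_def eigenspace_eq_span[symmetric] by auto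
  then have "{p. \<theta> p = \<mu>} \<noteq> {}" by (metis image_empty singletonD span_empty)
  then show "\<mu> \<in> range \<theta>" by auto
next
  assume "\<mu> \<in> range \<theta>"
  then show "is_eigenvalue A \<mu>"
    unfolding is_eigenvalue_def using eigen norm_basis by (metis imageE norm_zero zero_neq_one)
qed

text \<open>Connects the multiset behind \<open>graph_eigenvalue\<close> with
  \<open>\<theta>\<close>, which lists the eigenvalues in no particular order.\<close>

lemma eigenvalues_mset_eq: "eigenvalues_mset A = image_mset \<theta> (mset_set UNIV)"
proof (rule multiset_eqI)
  fix \<mu>
  have "count (eigenvalues_mset A) \<mu> = (\<Sum>\<nu>\<in>range \<theta>. if \<nu> = \<mu> then card {p. \<theta> p = \<nu>} else 0)"
    by (simp add: eigenvalues_mset_def is_eigenvalue_iff count_sum multiplicity_eq)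
  also have "\<dots> = card {p. \<theta> p = \<mu>}"
    by (auto simp: sum.delta intro!: arg_cong[of _ "{}" card])
  also have "\<dots> = count (image_mset \<theta> (mset_set UNIV)) \<mu>"
    by (simp add: count_image_mset_eq_card_vimage)
  finally show "count (eigenvalues_mset A) \<mu> = count (image_mset \<theta> (mset_set UNIV)) \<mu>" .
qed

lemma last_eigenvalue:
  defines "xs \<equiv> sorted_list_of_multiset (eigenvalues_mset A)"
  shows "rev xs ! (CARD('n) - 1) \<in> range \<theta>" "rev xs ! (CARD('n) - 1) \<le> \<theta> p"
proof -
  have len: "length xs = CARD('n)"
    unfolding xs_def by (metis eigenvalues_mset_eq mset_sorted_list_of_multiset size_image_mset size_mset size_mset_set)
  then have ne: "xs \<noteq> []" by auto
  have set: "set xs = range \<theta>"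
    by (simp add: xs_def eigenvalues_mset_eq)
  have eq: "rev xs ! (CARD('n) - 1) = xs ! 0"
    using len ne by (simp add: rev_nth)
  show "rev xs ! (CARD('n) - 1) \<in> range \<theta>"
    unfolding eq set[symmetric] using ne by auto
  have "sorted xs" by (simp add: xs_def)
  moreover have "\<theta> p \<in> set xs" by (simp add: set)
  ultimately show "rev xs ! (CARD('n) - 1) \<le> \<theta> p"
    unfolding eq by (cases xs) auto
qed

text \<open>Dropping the index \<open>z\<close> removes a single copy of the largest eigenvalue, so
  the second may equal the first; it is the maximum of what remains.\<close>

lemma second_eigenvalue:
  assumes "\<And>p. \<theta> p \<le> \<theta> z" "CARD('n) \<ge> 2"
  defines "xs \<equiv> sorted_list_of_multiset (eigenvalues_mset A)"
  shows "rev xs ! 1 \<in> \<theta> ` (- {z})" "p \<noteq> z \<Longrightarrow> \<theta> p \<le> rev xs ! 1"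
proof -
  define ys where "ys = sorted_list_of_multiset (image_mset \<theta> (mset_set (- {z})))"
  have set: "set ys = \<theta> ` (- {z})" by (simp add: ys_def)
  have "mset_set UNIV = add_mset z (mset_set (- {z}))"
    by (metis Compl_eq_Diff_UNIV UNIV_I finite mset_set.remove)
  then have "mset (ys @ [\<theta> z]) = eigenvalues_mset A"
    by (simp add: ys_def eigenvalues_mset_eq)
  moreover have "sorted (ys @ [\<theta> z])"
    using assms(1) by (auto simp: sorted_append set) (simp add: ys_def)
  ultimately have "xs = ys @ [\<theta> z]"
    unfolding xs_def by (metis sorted_list_of_multiset_mset sorted_sort_id)
  moreover have "ys \<noteq> []"
  proof
    assume "ys = []"
    then have "- {z} = {}" using set by simp
    then have "(UNIV :: 'n set) = {z}" by auto
    then have "CARD('n) = 1" by (metis card.empty card_insert_if empty_iff finite.emptyI One_nat_def)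
    then show False using assms(2) by simp
  qed
  ultimately have eq: "rev xs ! 1 = last ys"
    by (simp add: hd_rev[symmetric] hd_conv_nth)
  show "rev xs ! 1 \<in> \<theta> ` (- {z})"
    unfolding eq set[symmetric] using \<open>ys \<noteq> []\<close> by simp
  assume "p \<noteq> z"
  then have "\<theta> p \<in> set ys" by (simp add: set)
  then obtain m where "m < length ys" "ys ! m = \<theta> p" by (auto simp: in_set_conv_nth)
  moreover have "sorted ys" by (simp add: ys_def)
  ultimately show "\<theta> p \<le> rev xs ! 1"
    unfolding eq using \<open>ys \<noteq> []\<close> sorted_nth_mono[of ys m "length ys - 1"]
    by (simp add: last_conv_nth)
qed

end

subsection \<open>Equiangular systems\<close>

text \<open>For \<open>x = y\<close> this is twice the rank-one matrix of \<open>x\<close>, whence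
  the factors 2 and 4 below.\<close>

definition sym_outer :: "real ^ 'm \<Rightarrow> real ^ 'm \<Rightarrow> real ^ 'm ^ 'm" where
  "sym_outer x y = (\<chi> i j. x $ i * y $ j + y $ i * x $ j)"

lemma sym_outer_commute: "sym_outer x y = sym_outer y x"
  by (simp add: sym_outer_def vec_eq_iff)

lemma linear_sym_outer: "linear (sym_outer x)"
  by (rule linearI) (simp_all add: sym_outer_def vec_eq_iff algebra_simps)

lemma inner_sym_outer:
  "sym_outer x y \<bullet> sym_outer z t = 2 * ((x \<bullet> z) * (y \<bullet> t) + (x \<bullet> t) * (y \<bullet> z))"
  for x y z t :: "real ^ 'm"
proof -
  have "sym_outer x y \<bullet> sym_outer z t =
      (\<Sum>i\<in>UNIV. \<Sum>j\<in>UNIV. (x $ i * z $ i) * (y $ j * t $ j)) + (\<Sum>i\<in>UNIV. \<Sum>j\<in>UNIV. (x $ i * t $ i) * (y $ j * z $ j))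
      + (\<Sum>i\<in>UNIV. \<Sum>j\<in>UNIV. (y $ i * z $ i) * (x $ j * t $ j)) + (\<Sum>i\<in>UNIV. \<Sum>j\<in>UNIV. (y $ i * t $ i) * (x $ j * z $ j))"
    by (simp add: sym_outer_def inner_vec_def sum.distrib[symmetric] algebra_simps)
  also have "\<dots> = (x \<bullet> z) * (y \<bullet> t) + (x \<bullet> t) * (y \<bullet> z) + (y \<bullet> z) * (x \<bullet> t) + (y \<bullet> t) * (x \<bullet> z)"
    by (simp only: sum_product[symmetric] inner_vec_def inner_real_def)
  finally show ?thesis by simp
qed

text \<open>By bilinearity, extend from \<open>B\<close> to its span in one argument at a
  time.\<close>

lemma sym_outer_in_span:
  assumes "x \<in> span B" "y \<in> span B"
  shows "sym_outer x y \<in> span (case_prod sym_outer ` (B \<times> B))" (is "_ \<in> span ?Q")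
proof -
  have right: "sym_outer b z \<in> span ?Q" if "b \<in> B" "z \<in> span B" for b z
    using that(2)
  proof (induction rule: span_induct)
    case base
    show ?case using linear_subspace_vimage[OF linear_sym_outer[of b] subspace_span] by (simp add: vimage_def)
  next
    case (step z)
    then show ?case using that(1) by (intro span_base) force
  qed
  have "sym_outer y x \<in> span ?Q"
    using assms(1)
  proof (induction rule: span_induct)
    case base
    show ?case using linear_subspace_vimage[OF linear_sym_outer[of y] subspace_span] by (simp add: vimage_def)
  next
    case (step b)
    then show ?case using right[OF step assms(2)] by (simp add: sym_outer_commute)
  qed
  then show ?thesis by (simp add: sym_outer_commute)
qed

text \<open>By symmetry, adjoining \<open>b\<close> adds only its products with
  \<open>insert b B\<close>. This bounds the dimension of the space of symmetric matrices on the
  span of \<open>B\<close>.\<close>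

lemma card_sym_outer_image_le:
  assumes "finite B"
  shows "card (case_prod sym_outer ` (B \<times> B)) \<le> (card B + 1) choose 2"
  using assms
proof (induction B rule: finite_induct)
  case (insert b B)
  have "case_prod sym_outer ` (insert b B \<times> insert b B)
      \<subseteq> case_prod sym_outer ` (B \<times> B) \<union> sym_outer b ` insert b B"
  proof
    fix X assume "X \<in> case_prod sym_outer ` (insert b B \<times> insert b B)"
    then obtain c d where "X = sym_outer c d" "c \<in> insert b B" "d \<in> insert b B" by auto
    then show "X \<in> case_prod sym_outer ` (B \<times> B) \<union> sym_outer b ` insert b B"
      using sym_outer_commute[of c d] by force
  qed
  then have "card (case_prod sym_outer ` (insert b B \<times> insert b B))
      \<le> card (case_prod sym_outer ` (B \<times> B) \<union> sym_outer b ` insert b B)"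
    using insert.hyps(1) by (intro card_mono) auto
  also have "\<dots> \<le> card (case_prod sym_outer ` (B \<times> B)) + card (sym_outer b ` insert b B)"
    by (rule card_Un_le)
  also have "\<dots> \<le> ((card B + 1) choose 2) + card (insert b B)"
    using insert by (intro add_mono card_image_le) auto
  also have "\<dots> = (card (insert b B) + 1) choose 2"
    using insert.hyps by (simp add: numeral_2_eq_2)
  finally show ?case .
qed simp

locale equiangular_system =
  fixes v :: "'i::finite \<Rightarrow> real ^ 'm" and \<rho> s :: real
  assumes norm_sq: "v i \<bullet> v i = \<rho>"
    and angle_sq: "i \<noteq> j \<Longrightarrow> (v i \<bullet> v j)\<^sup>2 = 1 / 4"
    and sum_inner: "(\<Sum>j\<in>UNIV. v j) \<bullet> v i = s"
    and rho_ge: "\<rho> \<ge> 1 / 2" and s_pos: "s > 0"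
begin

definition w where "w = (\<Sum>j\<in>UNIV. v j)"

definition Z where "Z c = (\<Sum>i\<in>UNIV. c i *\<^sub>R sym_outer (v i) (v i))"

lemma w_inner: "w \<bullet> v i = s" "v i \<bullet> w = s"
  using sum_inner by (simp_all add: w_def inner_commute)

lemma w_inner_w: "w \<bullet> w = real CARD('i) * s"
  by (subst w_def) (simp add: inner_sum_left w_inner)

lemma sum_inner_v: "(\<Sum>i\<in>UNIV. u \<bullet> v i) = u \<bullet> w"
  by (simp add: w_def inner_sum_right)

text \<open>Equiangularity enters here: squaring removes the signs, so the matrices
  \<open>sym_outer (v i) (v i)\<close> have inner product \<open>4 * \<rho>\<^sup>2\<close> with
  themselves and 1 with each other.\<close>

lemma Z_inner_square:
  "Z c \<bullet> sym_outer (v j) (v j) = 4 * ((\<rho>\<^sup>2 - 1 / 4) * c j) + (\<Sum>i\<in>UNIV. c i)"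
proof -
  have "sym_outer (v i) (v i) \<bullet> sym_outer (v j) (v j) = 4 * (if i = j then \<rho>\<^sup>2 - 1 / 4 else 0) + 1" for i
    using angle_sq[of i j] norm_sq[of i] by (auto simp: inner_sym_outer power2_eq_square)
  then have "Z c \<bullet> sym_outer (v j) (v j) = (\<Sum>i\<in>UNIV. (if i = j then 4 * ((\<rho>\<^sup>2 - 1 / 4) * c j) else 0) + c i)"
    by (auto simp: Z_def inner_sum_left algebra_simps intro!: sum.cong)
  then show ?thesis
    by (simp add: sum.distrib)
qed

lemma Z_inner_Z:
  "Z c \<bullet> Z d = 4 * ((\<rho>\<^sup>2 - 1 / 4) * (\<Sum>i\<in>UNIV. c i * d i)) + (\<Sum>i\<in>UNIV. c i) * (\<Sum>i\<in>UNIV. d i)"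
proof -
  have "Z c \<bullet> Z d = (\<Sum>i\<in>UNIV. d i * (Z c \<bullet> sym_outer (v i) (v i)))"
    by (subst Z_def[of d]) (simp add: inner_sum_right)
  moreover define a where "a = \<rho>\<^sup>2 - 1 / 4"
  ultimately show ?thesis
    unfolding Z_inner_square a_def[symmetric]
    by (simp add: ring_distribs sum.distrib sum_distrib_left sum_distrib_right mult_ac)
qed

lemma inner_Z_sym_outer:
  "sym_outer u w \<bullet> Z c = 4 * s * (\<Sum>i\<in>UNIV. c i * (u \<bullet> v i))"
  by (simp add: Z_def inner_sum_right inner_sym_outer w_inner sum_distrib_left algebra_simps)

lemma sym_outer_inner_self:
  assumes "u \<bullet> w = 0"
  shows "sym_outer u w \<bullet> sym_outer u w = 2 * real CARD('i) * s * (u \<bullet> u)"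
  using assms by (simp add: inner_sym_outer w_inner_w)

text \<open>Cauchy--Schwarz for \<open>sym_outer u w\<close> against its projection onto the matrices
  \<open>sym_outer (v i) (v i)\<close>, whose Gram matrix is \<open>4 a I + J\<close> with \<open>a = \<rho>\<^sup>2 - 1 / 4\<close>.\<close>

lemma sum_inner_sq_le:
  assumes "u \<bullet> w = 0"
  shows "2 * s * (\<Sum>i\<in>UNIV. (u \<bullet> v i)\<^sup>2) \<le> (\<rho>\<^sup>2 - 1 / 4) * real CARD('i) * (u \<bullet> u)"
proof -
  define c where "c i = u \<bullet> v i" for i
  define C where "C = (\<Sum>i\<in>UNIV. (c i)\<^sup>2)"
  have a: "\<rho>\<^sup>2 - 1 / 4 \<ge> 0"
    using power_mono[OF rho_ge, of 2] by (simp add: power2_eq_square)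
  have C: "C \<ge> 0" by (simp add: C_def sum_nonneg)
  \<comment> \<open>The \<open>J\<close> part of the Gram matrix therefore vanishes on
    \<open>c\<close>, and up to scale \<open>c\<close> gives the coefficients of the
    projection.\<close>
  have "(sum c UNIV) = 0"
    using sum_inner_v[of u] assms by (simp add: c_def)
  then have "Z c \<bullet> Z c = 4 * ((\<rho>\<^sup>2 - 1 / 4) * C)"
    by (simp add: Z_inner_Z C_def power2_eq_square)
  moreover have "sym_outer u w \<bullet> Z c = 4 * s * C"
    by (simp add: inner_Z_sym_outer C_def c_def power2_eq_square)
  ultimately have "(4 * s * C)\<^sup>2 \<le> (2 * real CARD('i) * s * (u \<bullet> u)) * (4 * ((\<rho>\<^sup>2 - 1 / 4) * C))"
    using Cauchy_Schwarz_ineq[of "sym_outer u w" "Z c"] by (simp add: sym_outer_inner_self[OF assms])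
  then have "(8 * s * C) * (2 * s * C) \<le> (8 * s * C) * ((\<rho>\<^sup>2 - 1 / 4) * real CARD('i) * (u \<bullet> u))"
    by (simp add: power2_eq_square mult_ac)
  moreover have "0 < 8 * s * C" if "C \<noteq> 0"
    using that C s_pos by simp
  ultimately have "2 * s * C \<le> (\<rho>\<^sup>2 - 1 / 4) * real CARD('i) * (u \<bullet> u)" if "C \<noteq> 0"
    using that mult_le_cancel_left_pos by blast
  moreover have "0 \<le> (\<rho>\<^sup>2 - 1 / 4) * real CARD('i) * (u \<bullet> u)"
    using a by simp
  ultimately have "2 * s * C \<le> (\<rho>\<^sup>2 - 1 / 4) * real CARD('i) * (u \<bullet> u)"
    by (cases "C = 0") simp_all
  then show ?thesis
    unfolding C_def c_def .
qed

text \<open>Under the dimension hypothesis the matrices \<open>sym_outer (v i) (v i)\<close> span a hyperplane of the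
  symmetric matrices on \<open>span (range v)\<close>. Its normal \<open>Y\<close> is orthogonal to \<open>sym_outer u w\<close>, so the
  projection loses nothing.\<close>

lemma sum_inner_sq_eq:
  assumes u: "u \<bullet> w = 0" "u \<in> span (range v)"
    and dim: "(dim (range v) + 1) choose 2 \<le> CARD('i) + 1"
  shows "2 * s * (\<Sum>i\<in>UNIV. (u \<bullet> v i)\<^sup>2) = (\<rho>\<^sup>2 - 1 / 4) * real CARD('i) * (u \<bullet> u)"
proof (cases "\<rho>\<^sup>2 - 1 / 4 = 0 \<or> u = 0")
  \<comment> \<open>In these degenerate cases the upper bound of \<open>sum_inner_sq_le\<close> is
    already zero.\<close>
  case True
  have "(\<Sum>i\<in>UNIV. (u \<bullet> v i)\<^sup>2) = 0"
  proof (rule antisym)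
    show "(\<Sum>i\<in>UNIV. (u \<bullet> v i)\<^sup>2) \<le> 0"
      using sum_inner_sq_le[OF u(1)] s_pos True
      by (elim disjE) (simp_all add: mult_le_0_iff)
  qed (simp add: sum_nonneg)
  with True show ?thesis by auto
next
  case False
  define a where "a = \<rho>\<^sup>2 - 1 / 4"
  have a: "a > 0"
    using power_mono[OF rho_ge, of 2] False by (auto simp: a_def power2_eq_square)
  obtain B where B: "B \<subseteq> span (range v)" "pairwise orthogonal B" "\<And>x. x \<in> B \<Longrightarrow> norm x = 1"
      "independent B" "card B = dim (span (range v))" "span B = span (range v)"
    using orthonormal_basis_subspace[OF subspace_span] by blast
  have finB: "finite B" using B(4) independent_imp_finite by blast
  have v_in: "v i \<in> span B" for i unfolding B(6) by (rule span_base) simp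
  have w_in: "w \<in> span B" unfolding w_def by (intro span_sum v_in)
  have u_in: "u \<in> span B" using u(2) B(6) by simp
  let ?Q = "case_prod sym_outer ` (B \<times> B)"
  \<comment> \<open>\<open>I\<close> is twice the orthogonal projection onto the span of
    \<open>v\<close>, so there it pairs as twice the identity matrix would.\<close>
  define I where "I = (\<Sum>b\<in>B. sym_outer b b)"
  have I: "I \<bullet> sym_outer x y = 4 * (x \<bullet> y)" if "x \<in> span B" for x y
  proof -
    have "I \<bullet> sym_outer x y = 4 * ((\<Sum>b\<in>B. (x \<bullet> b) *\<^sub>R b) \<bullet> y)"
      by (simp add: I_def inner_sum_left inner_sym_outer sum_distrib_left inner_commute[of _ x] mult_ac)
    then show ?thesis
      using orthonormal_basis_expand[OF B(2,3) that finB] by simp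
  qed
  \<comment> \<open>Against \<open>sym_outer (v i) (v i)\<close> the matrix
    \<open>sym_outer w w\<close> gives \<open>4 * s\<^sup>2\<close> and \<open>I\<close> gives
    \<open>4 * \<rho>\<close>; the two scalars make these cancel.\<close>
  define Y where "Y = (1 / s\<^sup>2) *\<^sub>R sym_outer w w - (1 / \<rho>) *\<^sub>R I"
  define F where "F = range (\<lambda>i. sym_outer (v i) (v i))"
  have Y_F: "Y \<bullet> z = 0" if "z \<in> F" for z
    using that rho_ge s_pos
    by (auto simp: F_def Y_def inner_diff_left inner_sym_outer w_inner I v_in norm_sq power2_eq_square)
  have Y_X: "Y \<bullet> sym_outer u w = 0"
    using u(1) by (simp add: Y_def inner_diff_left inner_sym_outer I u_in inner_commute[of w u])
  have "Y \<bullet> sym_outer u u \<noteq> 0"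
    using u(1) rho_ge False by (simp add: Y_def inner_diff_left inner_sym_outer I u_in inner_commute[of w u])
  then have "Y \<noteq> 0" by auto
  \<comment> \<open>The residual of the projection. The coefficients solve the normal equations for
    \<open>4 a I + J\<close>: they sum to zero, so \<open>J\<close> drops out.\<close>
  define X' where "X' = sym_outer u w - Z (\<lambda>i. (s / a) * (u \<bullet> v i))"
  have sum0: "(\<Sum>i\<in>UNIV. u \<bullet> v i) = 0"
    using sum_inner_v[of u] u(1) by simp
  have X'_F: "X' \<bullet> z = 0" if "z \<in> F" for z
    using that a sum0
    by (auto simp: X'_def F_def inner_diff_left Z_inner_square inner_sym_outer w_inner sum_divide_distrib[symmetric] sum_distrib_left[symmetric] a_def[symmetric])
  have Y_span: "Y \<bullet> z = 0" if "z \<in> span F" for z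
    using orthogonal_to_span[OF that, of Y] Y_F by (simp add: orthogonal_def)
  have Z_in: "Z c \<in> span F" for c
    unfolding Z_def F_def by (intro span_sum span_scale span_base) auto
  have Y_X': "Y \<bullet> X' = 0"
    by (simp add: X'_def inner_diff_right Y_X Y_span[OF Z_in])
  have inj: "inj (\<lambda>i. sym_outer (v i) (v i))"
  proof (rule injI, rule ccontr)
    fix i j assume "sym_outer (v i) (v i) = sym_outer (v j) (v j)" "i \<noteq> j"
    then have "sym_outer (v i) (v i) \<bullet> sym_outer (v i) (v i) = sym_outer (v i) (v i) \<bullet> sym_outer (v j) (v j)"
      by simp
    with angle_sq[OF \<open>i \<noteq> j\<close>] a show False
      by (simp add: inner_sym_outer norm_sq a_def power2_eq_square)
  qed
  \<comment> \<open>The Gram matrix \<open>4 a I + J\<close> is positive definite because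
    \<open>a > 0\<close>.\<close>
  have indF: "independent F"
  proof (rule independent_if_scalars_zero)
    show "finite F" by (simp add: F_def)
    fix c z assume "(\<Sum>x\<in>F. c x *\<^sub>R x) = 0" and "z \<in> F"
    define d where "d i = c (sym_outer (v i) (v i))" for i
    have "Z d = 0"
      using \<open>(\<Sum>x\<in>F. c x *\<^sub>R x) = 0\<close> by (simp add: F_def Z_def d_def sum.reindex[OF inj] o_def)
    then have "4 * (a * (\<Sum>i\<in>UNIV. (d i)\<^sup>2)) + (\<Sum>i\<in>UNIV. d i)\<^sup>2 = 0"
      using Z_inner_Z[of d d] by (simp add: a_def power2_eq_square)
    moreover have "a * (\<Sum>i\<in>UNIV. (d i)\<^sup>2) \<ge> 0"
      using a by (simp add: sum_nonneg)
    ultimately have "a * (\<Sum>i\<in>UNIV. (d i)\<^sup>2) = 0"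
      by (smt (verit) zero_le_power2)
    then have "\<forall>i. d i = 0"
      using a by (simp add: sum_nonneg_eq_0_iff)
    then show "c z = 0"
      using \<open>z \<in> F\<close> by (auto simp: F_def d_def)
  qed
  \<comment> \<open>Otherwise \<open>F\<close>, \<open>Y\<close> and \<open>X'\<close> would provide
    \<open>CARD('i) + 2\<close> independent matrices in a space of dimension at most
    \<open>CARD('i) + 1\<close>.\<close>
  have "X' = 0"
  proof (rule ccontr)
    assume "X' \<noteq> 0"
    have "Y \<notin> span F"
      using Y_span[of Y] \<open>Y \<noteq> 0\<close> by auto
    have X'_span: "X' \<bullet> z = 0" if "z \<in> span (insert Y F)" for z
    proof -
      have "orthogonal X' y" if "y \<in> insert Y F" for y
        using that X'_F Y_X' by (auto simp: orthogonal_def inner_commute[of X' Y])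
      then show ?thesis
        using orthogonal_to_span[OF that] by (simp add: orthogonal_def)
    qed
    have "X' \<notin> span (insert Y F)"
      using \<open>X' \<noteq> 0\<close> X'_span[of X'] by auto
    with \<open>Y \<notin> span F\<close> have ind: "dim (insert X' (insert Y F)) = CARD('i) + 2"
      using dim_eq_card_independent[OF indF] card_image[OF inj] by (simp add: dim_insert F_def)
    have "F \<subseteq> span ?Q"
      using sym_outer_in_span[OF v_in v_in] by (auto simp: F_def)
    moreover have "Y \<in> span ?Q"
      unfolding Y_def I_def
      by (intro span_diff span_scale span_sum sym_outer_in_span w_in) (auto intro: span_base)
    moreover have "X' \<in> span ?Q"
      unfolding X'_def Z_def by (intro span_diff span_scale span_sum sym_outer_in_span w_in u_in v_in)
    ultimately have "dim (insert X' (insert Y F)) \<le> card ?Q"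
      using finB by (intro dim_le_card) auto
    also have "\<dots> \<le> (card B + 1) choose 2"
      by (rule card_sym_outer_image_le[OF finB])
    also have "\<dots> \<le> CARD('i) + 1"
      using dim by (simp add: B(5))
    finally show False using ind by simp
  qed
  then have "sym_outer u w \<bullet> sym_outer u w = sym_outer u w \<bullet> Z (\<lambda>i. (s / a) * (u \<bullet> v i))"
    by (simp add: X'_def)
  also have "\<dots> = 4 * s * (s / a) * (\<Sum>i\<in>UNIV. (u \<bullet> v i)\<^sup>2)"
    by (simp add: inner_Z_sym_outer sum_distrib_left power2_eq_square mult_ac)
  finally show ?thesis
    using a s_pos by (simp add: sym_outer_inner_self[OF u(1)] a_def[symmetric] field_simps)
qed

end

subsection \<open>Regular graphs with small spectral gap\<close>

lemma adjacency_matrix_nth: "adjacency_matrix E $ i $ j = (if E i j then 1 else 0)"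
  by (simp add: adjacency_matrix_def)

lemma transpose_adjacency_matrix: "simple_graph E \<Longrightarrow> transpose (adjacency_matrix E) = adjacency_matrix E"
  by (auto simp: simple_graph_def transpose_def adjacency_matrix_def vec_eq_iff dest: sympD)

lemma sum_adjacency_row:
  assumes "regular_graph k E"
  shows "(\<Sum>j\<in>UNIV. adjacency_matrix E $ i $ j) = real k"
  using assms by (simp add: adjacency_matrix_nth regular_graph_def sum.If_cases)

lemma sum_adjacency_column:
  assumes "regular_graph k E"
  shows "(\<Sum>j\<in>UNIV. adjacency_matrix E $ j $ i) = real k"
proof -
  have "adjacency_matrix E $ j $ i = adjacency_matrix E $ i $ j" for j
    using assms by (auto simp: adjacency_matrix_nth regular_graph_def simple_graph_def dest: sympD)
  then show ?thesis using sum_adjacency_row[OF assms] by simp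
qed

lemma degree_less_card:
  fixes E :: "'v::finite \<Rightarrow> 'v \<Rightarrow> bool"
  assumes "regular_graph k E"
  shows "k < CARD('v)"
proof -
  fix v :: 'v
  have "v \<notin> {w. E v w}" using assms by (auto simp: regular_graph_def simple_graph_def irreflp_def)
  then have "card {w. E v w} < CARD('v)" by (intro psubset_card_mono) auto
  then show ?thesis using assms by (simp add: regular_graph_def)
qed

text \<open>Compare both sides of the eigenvector equation at a coordinate of largest absolute
  value.\<close>

lemma abs_eigenvalue_le_degree:
  assumes "regular_graph k E" "adjacency_matrix E *v x = \<mu> *\<^sub>R x" "x \<noteq> 0"
  shows "\<bar>\<mu>\<bar> \<le> real k"
proof -
  define m where "m = Max (range (\<lambda>j. \<bar>x $ j\<bar>))"
  have "m \<in> range (\<lambda>j. \<bar>x $ j\<bar>)" unfolding m_def by (rule Max_in) auto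
  then obtain i where i: "m = \<bar>x $ i\<bar>" by auto
  have le: "\<bar>x $ j\<bar> \<le> \<bar>x $ i\<bar>" for j
    unfolding i[symmetric] m_def by (rule Max_ge) auto
  obtain j where "x $ j \<noteq> 0" using assms(3) by (auto simp: vec_eq_iff)
  then have pos: "0 < \<bar>x $ i\<bar>" using le[of j] by linarith
  have "\<bar>\<mu>\<bar> * \<bar>x $ i\<bar> = \<bar>(adjacency_matrix E *v x) $ i\<bar>"
    by (simp add: assms(2) abs_mult)
  also have "\<dots> \<le> (\<Sum>j\<in>UNIV. \<bar>adjacency_matrix E $ i $ j * x $ j\<bar>)"
    by (simp add: matrix_vector_mult_def sum_abs)
  also have "\<dots> \<le> (\<Sum>j\<in>UNIV. adjacency_matrix E $ i $ j * \<bar>x $ i\<bar>)"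
    using le by (intro sum_mono) (auto simp: adjacency_matrix_nth)
  also have "\<dots> = real k * \<bar>x $ i\<bar>"
    by (simp add: sum_distrib_right[symmetric] sum_adjacency_row[OF assms(1)])
  finally show ?thesis using pos by simp
qed

text \<open>\<open>z\<close> is the basis index of the normalised all-ones vector; it is a vertex
  only because the vertex type indexes the basis.\<close>

locale regular_graph_spectrum =
  orthonormal_eigenbasis "adjacency_matrix E" b \<theta>
  for E :: "'v::finite \<Rightarrow> 'v \<Rightarrow> bool" and b \<theta> +
  fixes k :: nat and z :: 'v
  assumes regular: "regular_graph k E" and degree_pos: "k \<ge> 1"
    and top: "b z = (\<chi> i. 1 / sqrt (real CARD('v)))" "\<theta> z = real k"
begin

abbreviation "A \<equiv> adjacency_matrix E"

lemma card_ge_2: "CARD('v) \<ge> 2"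
  using degree_less_card[OF regular] degree_pos by simp

lemma eigenvalue_abs_le: "\<bar>\<theta> p\<bar> \<le> real k"
  using abs_eigenvalue_le_degree[OF regular eigen, of p] norm_basis[of p] by fastforce

lemma sum_basis_component: "p \<noteq> z \<Longrightarrow> (\<Sum>i\<in>UNIV. b p $ i) = 0"
  using orthonormal[of p z] by (simp add: top inner_vec_def sum_divide_distrib[symmetric])

lemma sum_eigenvalues: "(\<Sum>p\<in>UNIV. \<theta> p) = 0"
proof -
  have "A $ i $ i = 0" for i
    using regular by (auto simp: adjacency_matrix_nth regular_graph_def simple_graph_def irreflp_def)
  then show ?thesis by (simp add: trace_eq[symmetric])
qed

text \<open>The squared norms of the columns of \<open>A\<close> count the ordered pairs of adjacent
  vertices.\<close>

lemma sum_eigenvalues_sq: "(\<Sum>p\<in>UNIV. (\<theta> p)\<^sup>2) = real CARD('v) * real k"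
proof -
  have "(A *v axis i 1) \<bullet> (A *v axis i 1) = (\<Sum>j\<in>UNIV. A $ j $ i)" for i
    by (simp add: matrix_vector_mult_basis column_def inner_vec_def adjacency_matrix_nth if_distrib cong: if_cong)
  then show ?thesis
    by (simp add: frobenius_eq[symmetric] sum_adjacency_column[OF regular])
qed

lemma least_eigenvalue_neg:
  assumes "\<And>p. m \<le> \<theta> p"
  shows "m < 0"
proof (rule ccontr)
  assume "\<not> m < 0"
  then have "\<theta> p \<ge> 0" for p using assms[of p] by linarith
  then have "\<theta> z = 0" using sum_eigenvalues by (simp add: sum_nonneg_eq_0_iff)
  then show False using top degree_pos by simp
qed

text \<open>The squares \<open>(\<theta> p + 1)\<^sup>2\<close> sum to
  \<open>CARD('v) * (k + 1)\<close>, and each eigenvalue \<open>k\<close> contributes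
  \<open>(k + 1)\<^sup>2\<close>. This reflects that every component has at least
  \<open>k + 1\<close> vertices.\<close>

lemma multiplicity_top_le: "card {p. \<theta> p = real k} * (k + 1) \<le> CARD('v)"
proof -
  have "real (card {p. \<theta> p = real k}) * (real k + 1)\<^sup>2 = (\<Sum>p\<in>{p. \<theta> p = real k}. (\<theta> p + 1)\<^sup>2)"
    by simp
  also have "\<dots> \<le> (\<Sum>p\<in>UNIV. (\<theta> p + 1)\<^sup>2)"
    by (rule sum_mono2) auto
  also have "\<dots> = real CARD('v) * (real k + 1)"
    by (simp add: power2_sum sum.distrib sum_eigenvalues_sq sum_distrib_left[symmetric] sum_distrib_right[symmetric] sum_eigenvalues algebra_simps)
  finally have "(real k + 1) * (real (card {p. \<theta> p = real k}) * (real k + 1)) \<le> (real k + 1) * real CARD('v)"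
    by (simp add: power2_eq_square mult_ac)
  then have "real (card {p. \<theta> p = real k}) * (real k + 1) \<le> real CARD('v)"
    by (subst (asm) mult_le_cancel_left_pos) auto
  then have "real (card {p. \<theta> p = real k} * (k + 1)) \<le> real CARD('v)"
    by (simp add: algebra_simps)
  then show ?thesis by (simp only: of_nat_le_iff)
qed

lemma sum_basis_products: "(\<Sum>p\<in>UNIV. b p $ i * b p $ j) = (if i = j then 1 else 0)"
proof -
  have "axis j 1 $ i = (\<Sum>p\<in>UNIV. b p $ i * b p $ j)"
    using parseval[of "axis i 1" "axis j 1"] by (simp add: inner_axis')
  then show ?thesis by (simp add: axis_def)
qed

lemma sum_eigenvalue_basis_products: "(\<Sum>p\<in>UNIV. \<theta> p * (b p $ i * b p $ j)) = A $ i $ j"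
proof -
  have "(A *v axis j 1) $ i = (\<Sum>p\<in>UNIV. \<theta> p * (b p $ i * b p $ j))"
    by (simp add: mult_vec_expansion inner_axis' mult_ac)
  then show ?thesis by (simp add: matrix_vector_mult_basis column_def)
qed

end

text \<open>\<open>l\<close> is the second eigenvalue; \<open>l = k\<close>, the disconnected case,
  is allowed.\<close>

locale regular_graph_gap = regular_graph_spectrum E b \<theta> k z
  for E :: "'v::finite \<Rightarrow> 'v \<Rightarrow> bool" and b \<theta> k z +
  fixes l :: real
  assumes second: "l \<in> \<theta> ` (- {z})" "\<And>p. p \<noteq> z \<Longrightarrow> \<theta> p \<le> l"
    and gap: "real k - l < real CARD('v) / 2"
begin

text \<open>The vectors \<open>v i\<close> have Gram matrix \<open>l I - A + J / 2\<close>, whose eigenvalues are the \<open>\<mu> p\<close>;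
  \<open>s\<close> is the one belonging to the all-ones vector.\<close>

definition s where "s = l - real k + real CARD('v) / 2"

definition \<mu> where "\<mu> p = (if p = z then s else l - \<theta> p)"

definition v :: "'v \<Rightarrow> real ^ 'v" where "v i = (\<chi> p. sqrt (\<mu> p) * b p $ i)"

text \<open>The gap hypothesis rearranged: positivity of the Gram matrix in the all-ones
  direction.\<close>

lemma s_pos: "s > 0" using gap by (simp add: s_def)

lemma mu_nonneg: "\<mu> p \<ge> 0" using s_pos second(2)[of p] by (simp add: \<mu>_def)

lemma gram: "v i \<bullet> v j = (if i = j then l else 0) - A $ i $ j + 1 / 2"
proof -
  have "sqrt (\<mu> p) * x * (sqrt (\<mu> p) * y) = \<mu> p * (x * y)" for p x y
  proof -
    have "sqrt (\<mu> p) * x * (sqrt (\<mu> p) * y) = (sqrt (\<mu> p) * sqrt (\<mu> p)) * (x * y)"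
      by (simp only: mult_ac)
    then show ?thesis using mu_nonneg[of p] by simp
  qed
  then have "v i \<bullet> v j = (\<Sum>p\<in>UNIV. \<mu> p * (b p $ i * b p $ j))"
    by (simp only: v_def inner_vec_def vec_lambda_beta inner_real_def)
  also have "\<dots> = (\<Sum>p\<in>UNIV. l * (b p $ i * b p $ j) - \<theta> p * (b p $ i * b p $ j) + (if p = z then 1 / 2 else 0))"
  proof (rule sum.cong[OF refl])
    fix p
    \<comment> \<open>The projector onto \<open>b z\<close> is constant, so the extra
      \<open>CARD('v) / 2\<close> in \<open>s\<close> becomes 1/2 in every entry.\<close>
    have "b z $ i * b z $ j = 1 / real CARD('v)" by (simp add: top)
    then show "\<mu> p * (b p $ i * b p $ j)
        = l * (b p $ i * b p $ j) - \<theta> p * (b p $ i * b p $ j) + (if p = z then 1 / 2 else 0)"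
      by (simp add: \<mu>_def s_def top(2) ring_distribs add_divide_distrib diff_divide_distrib)
  qed
  finally show ?thesis
    by (simp add: sum.distrib sum_subtractf sum_distrib_left[symmetric] sum_basis_products sum_eigenvalue_basis_products)
qed

lemma adjacent_irrefl: "\<not> E i i"
  using regular by (auto simp: regular_graph_def simple_graph_def irreflp_def)

text \<open>Distinct non-adjacent \<open>i\<close>, \<open>j\<close> give \<open>v i - v j\<close>
  squared norm \<open>2 * l\<close>. If \<open>l < 0\<close> the graph is thus complete, and its gap
  is too large.\<close>

lemma second_nonneg: "l \<ge> 0"
proof (rule ccontr)
  assume "\<not> l \<ge> 0"
  have "E i j" if "i \<noteq> j" for i j
  proof (rule ccontr)
    assume "\<not> E i j"
    then have "\<not> E j i" using regular by (auto simp: regular_graph_def simple_graph_def dest: sympD)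
    then have "(v i - v j) \<bullet> (v i - v j) = 2 * l"
      using \<open>i \<noteq> j\<close> \<open>\<not> E i j\<close> by (simp add: inner_diff_left inner_diff_right gram adjacency_matrix_nth adjacent_irrefl)
    then show False using \<open>\<not> l \<ge> 0\<close> inner_ge_zero[of "v i - v j"] by linarith
  qed
  then have "{w. E z w} = UNIV - {z}" using adjacent_irrefl by auto
  then have "card (UNIV - {z}) = k"
    using regular by (metis regular_graph_def)
  then have "k = CARD('v) - 1"
    by (simp add: card_Diff_singleton)
  then show False
    using gap card_ge_2 \<open>\<not> l \<ge> 0\<close> by (simp add: of_nat_diff)
qed

text \<open>Off the diagonal the Gram entries are 1/2 minus an adjacency entry, hence 1/2 up to
  sign; regularity makes the column sums equal.\<close>

sublocale equiangular_system v "l + 1 / 2" s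
proof
  show "v i \<bullet> v i = l + 1 / 2" for i
    by (simp add: gram adjacency_matrix_nth adjacent_irrefl)
  show "(v i \<bullet> v j)\<^sup>2 = 1 / 4" if "i \<noteq> j" for i j
    using that by (simp add: gram adjacency_matrix_nth power2_eq_square)
  show "(\<Sum>j\<in>UNIV. v j) \<bullet> v i = s" for i
    by (simp add: inner_sum_left gram sum.distrib sum_subtractf sum_adjacency_column[OF regular] s_def)
qed (use second_nonneg s_pos in auto)

text \<open>In these coordinates \<open>axis p 1\<close> represents the eigenvector
  \<open>b p\<close>, and \<open>w\<close> lies along the axis of \<open>z\<close>.\<close>

lemma axis_inner_w: "p \<noteq> z \<Longrightarrow> axis p 1 \<bullet> w = 0"
  by (simp add: inner_axis' w_def v_def sum_distrib_left[symmetric] sum_basis_component)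

lemma sum_axis_inner_sq:
  "(\<Sum>i\<in>UNIV. (axis p 1 \<bullet> v i)\<^sup>2) = \<mu> p"
  using mu_nonneg[of p]
  by (simp add: inner_axis' v_def power_mult_distrib sum_distrib_left[symmetric] sum_component_sq)

lemma axis_in_span:
  assumes "\<mu> p \<noteq> 0"
  shows "axis p 1 \<in> span (range v)"
proof -
  have "(\<Sum>i\<in>UNIV. b p $ i *\<^sub>R v i) = sqrt (\<mu> p) *\<^sub>R axis p 1"
  proof (rule vec_eq_iff[THEN iffD2, rule_format])
    fix q
    have "(\<Sum>i\<in>UNIV. b p $ i *\<^sub>R v i) $ q = sqrt (\<mu> q) * (b p \<bullet> b q)"
      by (simp add: v_def inner_vec_def sum_distrib_left mult_ac)
    then show "(\<Sum>i\<in>UNIV. b p $ i *\<^sub>R v i) $ q = (sqrt (\<mu> p) *\<^sub>R axis p 1) $ q"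
      by (simp add: orthonormal axis_def)
  qed
  then have "axis p 1 = (1 / sqrt (\<mu> p)) *\<^sub>R (\<Sum>i\<in>UNIV. b p $ i *\<^sub>R v i)"
    using assms by simp
  also have "\<dots> \<in> span (range v)"
    by (intro span_scale span_sum span_base) auto
  finally show ?thesis .
qed

text \<open>Every \<open>v i\<close> vanishes in the coordinates with
  \<open>\<mu> p = 0\<close>.\<close>

lemma dim_le: "dim (range v) \<le> card {p. \<mu> p \<noteq> 0}"
proof -
  have "v i \<in> span ((\<lambda>p. axis p 1) ` {p. \<mu> p \<noteq> 0})" for i
  proof -
    have "(v i $ p) *\<^sub>R axis p 1 \<in> span ((\<lambda>p. axis p 1 :: real ^ 'v) ` {p. \<mu> p \<noteq> 0})" for p
    proof (cases "\<mu> p = 0")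
      case False then show ?thesis by (intro span_scale span_base) auto
    qed (simp add: v_def span_zero)
    then have "(\<Sum>p\<in>UNIV. (v i $ p) *\<^sub>R axis p 1) \<in> span ((\<lambda>p. axis p 1 :: real ^ 'v) ` {p. \<mu> p \<noteq> 0})"
      by (intro span_sum)
    then show ?thesis
      by (simp only: basis_expansion scalar_mult_eq_scaleR[symmetric])
  qed
  then have "dim (range v) \<le> card ((\<lambda>p. axis p 1 :: real ^ 'v) ` {p. \<mu> p \<noteq> 0})"
    by (intro dim_le_card) auto
  also have "\<dots> \<le> card {p. \<mu> p \<noteq> 0}" by (rule card_image_le) simp
  finally show ?thesis .
qed

section \<open>The bound on the last eigenvalue\<close>

lemma a_eq: "(l + 1 / 2)\<^sup>2 - 1 / 4 = l * (l + 1)"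
  by (simp add: power2_eq_square algebra_simps)

lemma gap_eq: "1 - 2 * (real k - l) / real CARD('v) = 2 * s / real CARD('v)"
  by (simp add: s_def field_simps)

text \<open>This is \<open>sum_inner_sq_le\<close> for the unit vector \<open>axis p 1\<close>,
  whose sum of squares is \<open>\<mu> p = l - \<theta> p\<close>.\<close>

lemma last_bound:
  assumes "p \<noteq> z"
  shows "- \<theta> p \<le> l * (l + 1) / (1 - 2 * (real k - l) / real CARD('v)) - l"
proof -
  have "2 * s * (l - \<theta> p) \<le> l * (l + 1) * real CARD('v)"
    using sum_inner_sq_le[OF axis_inner_w[OF assms]] assms
    by (simp add: inner_axis_axis sum_axis_inner_sq a_eq \<mu>_def)
  then show ?thesis
    unfolding gap_eq using s_pos by (simp add: field_simps)
qed

text \<open>\<open>\<theta> p \<noteq> l\<close> makes \<open>\<mu> p\<close> nonzero, which puts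
  \<open>axis p 1\<close> into the span of the \<open>v i\<close>.\<close>

lemma last_eq:
  assumes "p \<noteq> z" "\<theta> p \<noteq> l" "(dim (range v) + 1) choose 2 \<le> CARD('v) + 1"
  shows "- \<theta> p = l * (l + 1) / (1 - 2 * (real k - l) / real CARD('v)) - l"
proof -
  have "axis p 1 \<in> span (range v)"
    using assms by (intro axis_in_span) (simp add: \<mu>_def)
  then have "2 * s * (l - \<theta> p) = l * (l + 1) * real CARD('v)"
    using sum_inner_sq_eq[OF axis_inner_w[OF assms(1)] _ assms(3)] assms(1)
    by (simp add: inner_axis_axis sum_axis_inner_sq a_eq \<mu>_def)
  then show ?thesis
    unfolding gap_eq using s_pos by (simp add: field_simps)
qed

section \<open>The bound on the degree\<close>

definition u where "u = v z - (1 / real CARD('v)) *\<^sub>R w"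

text \<open>The coefficient of \<open>w\<close> in \<open>u\<close> is the quotient of
  \<open>v z \<bullet> w = s\<close> by \<open>w \<bullet> w = CARD('v) * s\<close>.\<close>

lemma u_inner_w: "u \<bullet> w = 0"
  by (simp add: u_def inner_diff_left w_inner w_inner_w)

lemma u_inner_u: "u \<bullet> u = l + 1 / 2 - s / real CARD('v)"
proof -
  have "u \<bullet> u = u \<bullet> v z"
    using u_inner_w by (subst (2) u_def) (simp add: inner_diff_right)
  then show ?thesis by (simp add: u_def inner_diff_left norm_sq w_inner)
qed

lemma sum_u_inner_sq:
  "(\<Sum>i\<in>UNIV. (u \<bullet> v i)\<^sup>2) = l * (l + 1) + (real k - l) - (real k - l)\<^sup>2 / real CARD('v)"
proof -
  \<comment> \<open>All squares are 1/4 except that of \<open>v z \<bullet> v z\<close>, which is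
    \<open>l * (l + 1) + 1 / 4\<close>.\<close>
  have "(\<Sum>i\<in>UNIV. (v z \<bullet> v i)\<^sup>2) = (\<Sum>i\<in>UNIV. (if z = i then l * (l + 1) else 0) + 1 / 4)"
    by (intro sum.cong) (use a_eq norm_sq angle_sq in auto)
  then have sq: "(\<Sum>i\<in>UNIV. (v z \<bullet> v i)\<^sup>2) = l * (l + 1) + real CARD('v) / 4"
    by (simp add: sum.distrib)
  have "(u \<bullet> v i)\<^sup>2 = (v z \<bullet> v i)\<^sup>2 - (2 * s / real CARD('v)) * (v z \<bullet> v i) + (s / real CARD('v))\<^sup>2" for i
    by (simp add: u_def inner_diff_left w_inner power2_eq_square algebra_simps)
  then have "(\<Sum>i\<in>UNIV. (u \<bullet> v i)\<^sup>2) = (\<Sum>i\<in>UNIV. (v z \<bullet> v i)\<^sup>2)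
      - (2 * s / real CARD('v)) * (\<Sum>i\<in>UNIV. v z \<bullet> v i) + real CARD('v) * (s / real CARD('v))\<^sup>2"
    by (simp only: sum.distrib sum_subtractf sum_distrib_left sum_constant)
  also have "\<dots> = l * (l + 1) + real CARD('v) / 4 - s\<^sup>2 / real CARD('v)"
    unfolding sq sum_inner_v w_inner by (simp add: power2_eq_square field_simps)
  also have "\<dots> = l * (l + 1) + (real k - l) - (real k - l)\<^sup>2 / real CARD('v)"
    by (simp add: s_def power2_eq_square field_simps)
  finally show ?thesis .
qed

text \<open>The degree bound is \<open>sum_inner_sq_le\<close> for the projection \<open>u\<close> of a single \<open>v z\<close> away from \<open>w\<close>
  (the vertex \<open>z\<close> is arbitrary here).\<close>

lemma degree_defect:
  "s * (l * (l + 1) * (2 * l + 1) / (1 - 2 * (real k - l) / real CARD('v)) - l * (3 * l + 1) - 2 * (real k - (real k - l)\<^sup>2 / real CARD('v)))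
    = l * (l + 1) * real CARD('v) * (u \<bullet> u) - 2 * s * (\<Sum>i\<in>UNIV. (u \<bullet> v i)\<^sup>2)"
proof -
  have "s * (l * (l + 1) * (2 * l + 1) / (2 * s / real CARD('v))) = l * (l + 1) * real CARD('v) * (l + 1 / 2)"
    using s_pos by (simp add: field_simps)
  then show ?thesis
    unfolding gap_eq u_inner_u sum_u_inner_sq using s_pos
    by (simp add: algebra_simps)
qed

lemma degree_bound:
  "2 * (real k - (real k - l)\<^sup>2 / real CARD('v))
    \<le> l * (l + 1) * (2 * l + 1) / (1 - 2 * (real k - l) / real CARD('v)) - l * (3 * l + 1)"
proof -
  have "0 \<le> s * (l * (l + 1) * (2 * l + 1) / (1 - 2 * (real k - l) / real CARD('v)) - l * (3 * l + 1) - 2 * (real k - (real k - l)\<^sup>2 / real CARD('v)))"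
    unfolding degree_defect using sum_inner_sq_le[OF u_inner_w] by (simp add: a_eq)
  then show ?thesis
    using s_pos by (simp add: zero_le_mult_iff)
qed

text \<open>\<open>u\<close> lies in the span of the \<open>v i\<close>, so the right side of
  \<open>degree_defect\<close> vanishes.\<close>

lemma degree_eq:
  assumes "(dim (range v) + 1) choose 2 \<le> CARD('v) + 1"
  shows "2 * (real k - (real k - l)\<^sup>2 / real CARD('v))
    = l * (l + 1) * (2 * l + 1) / (1 - 2 * (real k - l) / real CARD('v)) - l * (3 * l + 1)"
proof -
  have "u \<in> span (range v)"
    unfolding u_def w_def by (intro span_diff span_scale span_sum span_base) auto
  then have "s * (l * (l + 1) * (2 * l + 1) / (1 - 2 * (real k - l) / real CARD('v)) - l * (3 * l + 1) - 2 * (real k - (real k - l)\<^sup>2 / real CARD('v))) = 0"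
    unfolding degree_defect using sum_inner_sq_eq[OF u_inner_w _ assms] by (simp add: a_eq)
  then show ?thesis
    using s_pos by simp
qed

text \<open>If \<open>l = k\<close> then \<open>l\<close> has multiplicity one more than the nullity of \<open>l I - A + J / 2\<close>, so the
  equality condition of the theorem does not match the dimension hypothesis of \<open>sum_inner_sq_eq\<close>;
  it then holds at most for perfect matchings.\<close>

lemma second_eq_degree_cases:
  assumes "l = real k" "CARD('v) + 1 = (CARD('v) - card {p. \<theta> p = l} + 1) choose 2"
  shows "k = 1"
proof (rule ccontr)
  define c d where "c = card {p. \<theta> p = l}" and "d = CARD('v) - c"
  assume "k \<noteq> 1"
  \<comment> \<open>With \<open>k \<ge> 2\<close> the multiplicity bound gives
    \<open>3 * c \<le> CARD('v)\<close>, that is, \<open>2 * c \<le> d\<close>.\<close>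
  then have "c * 3 \<le> c * (k + 1)" using degree_pos by (intro mult_le_mono2) simp
  also have "\<dots> \<le> CARD('v)" using multiplicity_top_le by (simp add: c_def assms(1))
  finally have c3: "c * 3 \<le> CARD('v)" .
  obtain q where "q \<noteq> z" "\<theta> q = l" using second(1) by auto
  then have "card {z, q} \<le> c"
    unfolding c_def using top assms(1) by (intro card_mono) auto
  then have c2: "c \<ge> 2" using \<open>q \<noteq> z\<close> by simp
  have n_eq: "CARD('v) = c + d" using c3 by (simp add: d_def)
  have "2 * ((d + 1) choose 2) = (d + 1) * d"
    by (simp add: choose_two)
  then have "(d + 1) * d = 2 * (c + d + 1)"
    using assms(2) by (simp add: c_def[symmetric] d_def[symmetric] n_eq)
  \<comment> \<open>Inserting \<open>2 * c \<le> d\<close> leaves a quadratic bound that forces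
    \<open>d < 3\<close>, whereas \<open>c \<ge> 2\<close> gives \<open>d \<ge> 4\<close>.\<close>
  then have "d * d \<le> 2 * d + 2"
    using c3 n_eq by (simp add: algebra_simps)
  moreover have "3 * d \<le> d * d" if "\<not> d < 3"
    using that by simp
  ultimately have "d < 3" by linarith
  then show False using c2 c3 n_eq by simp
qed

end

theorem theorem1p15:
  fixes E :: "'v::finite \<Rightarrow> 'v \<Rightarrow> bool" and k n :: nat and lam2 lamn :: real
  assumes "k \<ge> 1"
    and "n = CARD('v)"
    and "regular_graph k E"
    and "lam2 = graph_eigenvalue E 2"
    and "lamn = graph_eigenvalue E n"
    and "real k - lam2 < real n / 2"
  shows "2 * (real k - (real k - lam2)\<^sup>2 / real n)
           \<le> lam2 * (lam2 + 1) * (2 * lam2 + 1) / (1 - 2 * (real k - lam2) / real n) - lam2 * (3 * lam2 + 1)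
       \<and> - lamn \<le> lam2 * (lam2 + 1) / (1 - 2 * (real k - lam2) / real n) - lam2
       \<and> (int n = int ((n - graph_multiplicity E lam2 + 1) choose 2) - 1 \<longrightarrow>
            2 * (real k - (real k - lam2)\<^sup>2 / real n)
              = lam2 * (lam2 + 1) * (2 * lam2 + 1) / (1 - 2 * (real k - lam2) / real n) - lam2 * (3 * lam2 + 1)
          \<and> - lamn = lam2 * (lam2 + 1) / (1 - 2 * (real k - lam2) / real n) - lam2)"
proof -
  let ?A = "adjacency_matrix E"
  define e :: "real ^ 'v" where "e = (\<chi> i. 1 / sqrt (real CARD('v)))"
  have norm_e: "norm e = 1"
    by (simp add: e_def norm_eq_1 inner_vec_def)
  have eigen_e: "?A *v e = real k *\<^sub>R e"
    by (simp add: e_def matrix_vector_mult_def vec_eq_iff sum_divide_distrib[symmetric] sum_adjacency_row[OF assms(3)])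
  have "transpose ?A = ?A"
    using assms(3) by (simp add: regular_graph_def transpose_adjacency_matrix)
  from this norm_e eigen_e obtain b \<theta> and z :: 'v where basis:
      "\<And>p q. b p \<bullet> b q = (if p = q then 1 else 0)" "\<And>p. ?A *v b p = \<theta> p *\<^sub>R b p"
      "b z = e" "\<theta> z = real k"
    by (rule orthonormal_eigenbasis_exists) (rule that)
  interpret regular_graph_spectrum E b \<theta> k z
    using basis assms(1,3) by unfold_locales (simp_all add: e_def)
  have top_max: "\<theta> p \<le> \<theta> z" for p
    using eigenvalue_abs_le[of p] by (simp add: top(2))
  have lam2: "lam2 \<in> \<theta> ` (- {z})" "\<And>p. p \<noteq> z \<Longrightarrow> \<theta> p \<le> lam2"
    using second_eigenvalue[OF top_max card_ge_2] by (simp_all add: assms(4) graph_eigenvalue_def)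
  interpret regular_graph_gap E b \<theta> k z lam2
    using lam2 assms(2,6) by unfold_locales auto
  have lamn: "lamn \<in> range \<theta>" "\<And>p. lamn \<le> \<theta> p"
    using last_eigenvalue by (simp_all add: assms(2,5) graph_eigenvalue_def)
  then obtain q where q: "lamn = \<theta> q" by auto
  have "lamn < 0"
    using least_eigenvalue_neg lamn(2) by blast
  \<comment> \<open>Both \<open>k\<close> and \<open>lam2\<close> are non-negative, so the negative
    \<open>lamn\<close> differs from them.\<close>
  then have "q \<noteq> z" "\<theta> q \<noteq> lam2"
    using q top(2) second_nonneg by auto
  have "2 * (real k - (real k - lam2)\<^sup>2 / real n)
          = lam2 * (lam2 + 1) * (2 * lam2 + 1) / (1 - 2 * (real k - lam2) / real n) - lam2 * (3 * lam2 + 1)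
      \<and> - lamn = lam2 * (lam2 + 1) / (1 - 2 * (real k - lam2) / real n) - lam2"
    if "int n = int ((n - graph_multiplicity E lam2 + 1) choose 2) - 1"
  proof -
    have n: "CARD('v) + 1 = (CARD('v) - card {p. \<theta> p = lam2} + 1) choose 2"
      using that by (simp add: graph_multiplicity_def multiplicity_eq assms(2))
    show ?thesis
    proof (cases "lam2 = real k")
      case False
      \<comment> \<open>At \<open>z\<close> both conditions hold, since
        \<open>\<mu> z = s > 0\<close> and \<open>\<theta> z = k\<close> differs from
        \<open>lam2\<close>. So the dimension is at most \<open>n\<close> minus the
        multiplicity.\<close>
      then have "{p. \<mu> p \<noteq> 0} = - {p. \<theta> p = lam2}"
        using s_pos top(2) by (auto simp: \<mu>_def)
      then have "card {p. \<mu> p \<noteq> 0} = CARD('v) - card {p. \<theta> p = lam2}"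
        by (simp add: Compl_eq_Diff_UNIV card_Diff_subset)
      then have "(dim (range v) + 1) choose 2 \<le> CARD('v) + 1"
        using dim_le by (subst n) (intro binomial_right_mono, simp)
      then show ?thesis
        using degree_eq last_eq[OF \<open>q \<noteq> z\<close> \<open>\<theta> q \<noteq> lam2\<close>] by (simp add: assms(2) q)
    next
      case True
      then have "k = 1" using second_eq_degree_cases n by blast
      \<comment> \<open>For \<open>k = 1\<close> the squared eigenvalues are at most 1 and sum to
        \<open>n\<close>, so all equal 1; with \<open>lamn = - 1\<close> both equalities are
        numerical.\<close>
      have "\<theta> p ^ 2 \<le> 1" for p
        using eigenvalue_abs_le[of p] \<open>k = 1\<close> by (simp add: abs_square_le_1)
      moreover have "(\<Sum>p\<in>UNIV. 1 - (\<theta> p)\<^sup>2) = 0"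
        by (simp add: sum_subtractf sum_eigenvalues_sq \<open>k = 1\<close>)
      ultimately have "lamn\<^sup>2 = 1"
        using sum_nonneg_eq_0_iff[of UNIV "\<lambda>p. 1 - (\<theta> p)\<^sup>2"] by (simp add: q)
      then have "lamn = - 1"
        using \<open>lamn < 0\<close> by (auto simp: power2_eq_1_iff)
      then show ?thesis using True \<open>k = 1\<close> by simp
    qed
  qed
  moreover have "2 * (real k - (real k - lam2)\<^sup>2 / real n)
      \<le> lam2 * (lam2 + 1) * (2 * lam2 + 1) / (1 - 2 * (real k - lam2) / real n) - lam2 * (3 * lam2 + 1)"
    using degree_bound by (simp add: assms(2))
  moreover have "- lamn \<le> lam2 * (lam2 + 1) / (1 - 2 * (real k - lam2) / real n) - lam2"
    using last_bound[OF \<open>q \<noteq> z\<close>] by (simp add: assms(2) q)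
  ultimately show ?thesis by blast
qed

end
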